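(* There is no functional $\Theta$ satisfying $\textsf{SFF}(\Theta)$ that is computable in $\exists^2$.
   Context: The metatheory is $\textsf{ZFC}$ and functionals live in the full (set-theoretic) type structure over $\mathbb{N}$. "Computable" (in given functionals) means Kleene computable via the schemes S1–S9. For $f\in\mathbb{N}^{\mathbb{N}}$, $\overline{f}N=\langle f(0),\dots,f(N-1)\rangle$; for a finite sequence $\sigma$, $f\in[\sigma]$ means $f$ extends $\sigma$. A functional $\Theta$ of type $2\to1^*$ assigns to every $G:\mathbb{N}^{\mathbb{N}}\to\mathbb{N}$ a finite sequence $\Theta(G)=\langle f_0,\dots,f_k\rangle$ of elements of $\mathbb{N}^{\mathbb{N}}$. $\textsf{SFF}(\Theta)$ ("$\Theta$ is a special fan functional") is the statement: for all $G:\mathbb{N}^{\mathbb{N}}\to\mathbb{N}$ and all $f\in2^{\mathbb{N}}$ there is an entry $g$ of $\Theta(G)$ with $f\in[\overline{g}G(g)]$. That such a $\Theta$ is computable means that the (suitably coded) map giving the length of $\Theta(G)$ and the values $\Theta(G)(i)(n)$ is computable. $\exists^2:\mathbb{N}^{\mathbb{N}}\to\{0,1\}$ is the functional with $\exists^2(f)=0$ if and only if $(\exists n)(f(n)=0)$. *)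

theory Defs
  imports Complex_Main "HOL-Library.Nat_Bijection"
begin

type_synonym type1 = "nat \<Rightarrow> nat"
type_synonym type2 = "type1 \<Rightarrow> nat"

text \<open>
  Kleene's schemes S1--S9 for argument lists \<open>xs\<close>, \<open>fs\<close>, \<open>Fs\<close> of types 0, 1 and 2.
  \<open>kleene e xs fs Fs y\<close> means that \<open>{e}(xs, fs, Fs)\<close> is defined with value \<open>y\<close>; the
  computation relation is the least one closed under the schemes.

  No scheme leads to arguments of type 3 or higher from arguments of type at most 2
  (S8 for a type 2 argument adds only a number), so on such arguments this is
  Kleene's computability over the full type structure.

  Indices are natural numbers (as S9 needs), coded effectively by \<^const>\<open>list_encode\<close>.
  They carry no record of the numbers of arguments of each type; if the arguments at hand do
  not fit a scheme, the computation is undefined.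
\<close>

definition move_to_front :: "nat \<Rightarrow> 'a list \<Rightarrow> 'a list" where
  "move_to_front k xs = xs ! k # take k xs @ drop (Suc k) xs"

inductive kleene :: "nat \<Rightarrow> nat list \<Rightarrow> type1 list \<Rightarrow> type2 list \<Rightarrow> nat \<Rightarrow> bool" where
  S1: "kleene (list_encode [1]) (x # xs) fs Fs (Suc x)"
| S2: "kleene (list_encode [2, q]) xs fs Fs q"
| S3: "kleene (list_encode [3]) (x # xs) fs Fs x"
| S4: "kleene h xs fs Fs y \<Longrightarrow> kleene g (y # xs) fs Fs z \<Longrightarrow>
       kleene (list_encode [4, g, h]) xs fs Fs z"
| S5_0: "kleene g xs fs Fs y \<Longrightarrow> kleene (list_encode [5, g, h]) (0 # xs) fs Fs y"
| S5_Suc: "kleene (list_encode [5, g, h]) (x # xs) fs Fs y \<Longrightarrow>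
       kleene h (x # y # xs) fs Fs z \<Longrightarrow>
       kleene (list_encode [5, g, h]) (Suc x # xs) fs Fs z"
| S6_0: "k < length xs \<Longrightarrow> kleene g (move_to_front k xs) fs Fs y \<Longrightarrow>
       kleene (list_encode [6, 0, k, g]) xs fs Fs y"
| S6_1: "k < length fs \<Longrightarrow> kleene g xs (move_to_front k fs) Fs y \<Longrightarrow>
       kleene (list_encode [6, 1, k, g]) xs fs Fs y"
| S6_2: "k < length Fs \<Longrightarrow> kleene g xs fs (move_to_front k Fs) y \<Longrightarrow>
       kleene (list_encode [6, 2, k, g]) xs fs Fs y"
| S7: "kleene (list_encode [7]) (x # xs) (f # fs) Fs (f x)"
| S8: "(\<And>x. kleene h (x # xs) fs (F # Fs) (u x)) \<Longrightarrow>
       kleene (list_encode [8, h]) xs fs (F # Fs) (F u)"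
| S9: "m0 \<le> length xs \<Longrightarrow> m1 \<le> length fs \<Longrightarrow> m2 \<le> length Fs \<Longrightarrow>
       kleene d (take m0 xs) (take m1 fs) (take m2 Fs) y \<Longrightarrow>
       kleene (list_encode [9, m0, m1, m2]) (d # xs) fs Fs y"

definition exists2 :: type2 where
  "exists2 f = (if \<exists>n. f n = 0 then 0 else 1)"

definition initial_segment :: "type1 \<Rightarrow> nat \<Rightarrow> nat list" where
  "initial_segment f N = map f [0..<N]"

definition neighbourhood :: "nat list \<Rightarrow> type1 set" where
  "neighbourhood \<sigma> = {f. \<forall>i<length \<sigma>. f i = \<sigma> ! i}"

definition Cantor_space :: "type1 set" where
  "Cantor_space = {f. \<forall>n. f n \<in> {0, 1}}"

definition SFF :: "(type2 \<Rightarrow> type1 list) \<Rightarrow> bool" where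
  "SFF \<Theta> \<longleftrightarrow>
    (\<forall>G. \<forall>f\<in>Cantor_space. \<exists>g\<in>set (\<Theta> G). f \<in> neighbourhood (initial_segment g (G g)))"

text \<open>
  The length of \<open>\<Theta>(G)\<close> and the values \<open>\<Theta>(G)(i)(n)\<close> are computed by indices that do not
  depend on \<open>G\<close>. Nothing is required of the second index for \<open>i\<close> outside the range of
  \<open>\<Theta>(G)\<close>.
\<close>

definition computable_in :: "(type2 \<Rightarrow> type1 list) \<Rightarrow> type2 \<Rightarrow> bool" where
  "computable_in \<Theta> \<Phi> \<longleftrightarrow>
    (\<exists>l e. \<forall>G. kleene l [] [] [\<Phi>, G] (length (\<Theta> G)) \<and>
      (\<forall>i<length (\<Theta> G). \<forall>n. kleene e [i, n] [] [\<Phi>, G] ((\<Theta> G ! i) n)))"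

end

theory Submission
  imports Defs "HOL-Library.Countable"
begin

text \<open>
  Call a partial type 2 object good if each of its values \<open>G(u)\<close> is the successor of a code of a
  computation of \<open>u\<close> in \<open>\<exists>\<^sup>2\<close> and \<open>G\<close> itself. A maximal good partial object, which exists by Zorn's
  lemma, is defined at every function computable in \<open>\<exists>\<^sup>2\<close> and itself, so replacing it by a total
  extension \<open>G\<close> changes no computation. Hence the entries of \<open>\<Theta>(G)\<close> lie in the domain of
  the partial object, where \<open>G\<close> is injective since a code determines the computed function. A binary
  sequence that differs at \<open>p\<close> from the only entry \<open>g\<close> with \<open>G(g) = p + 1\<close>, for every \<open>p\<close>, then
  avoids all neighbourhoods given by \<open>\<Theta>(G)\<close>. This replaces the usual appeal to Gandy
  selection and uses nothing about \<open>\<exists>\<^sup>2\<close>.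
\<close>

text \<open>
  Here \<open>R\<close> is the graph of a partial type 2 object. A list of type 2 arguments is given by a list
  of Booleans, with \<^const>\<open>True\<close> for \<open>R\<close> and \<^const>\<open>False\<close> for \<open>\<Phi>\<close>. There are no
  type 1 arguments, so S6 for type 1 and S7 do not arise.
\<close>

inductive pkleene :: "type2 \<Rightarrow> (type1 \<times> nat) set \<Rightarrow> nat \<Rightarrow> nat list \<Rightarrow> bool list \<Rightarrow> nat \<Rightarrow> bool"
  for \<Phi> R where
  P1: "pkleene \<Phi> R (list_encode [1]) (x # xs) bs (Suc x)"
| P2: "pkleene \<Phi> R (list_encode [2, q]) xs bs q"
| P3: "pkleene \<Phi> R (list_encode [3]) (x # xs) bs x"
| P4: "pkleene \<Phi> R h xs bs y \<Longrightarrow> pkleene \<Phi> R g (y # xs) bs z \<Longrightarrow>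
       pkleene \<Phi> R (list_encode [4, g, h]) xs bs z"
| P5_0: "pkleene \<Phi> R g xs bs y \<Longrightarrow> pkleene \<Phi> R (list_encode [5, g, h]) (0 # xs) bs y"
| P5_Suc: "pkleene \<Phi> R (list_encode [5, g, h]) (x # xs) bs y \<Longrightarrow>
       pkleene \<Phi> R h (x # y # xs) bs z \<Longrightarrow>
       pkleene \<Phi> R (list_encode [5, g, h]) (Suc x # xs) bs z"
| P6_0: "k < length xs \<Longrightarrow> pkleene \<Phi> R g (move_to_front k xs) bs y \<Longrightarrow>
       pkleene \<Phi> R (list_encode [6, 0, k, g]) xs bs y"
| P6_2: "k < length bs \<Longrightarrow> pkleene \<Phi> R g xs (move_to_front k bs) y \<Longrightarrow>
       pkleene \<Phi> R (list_encode [6, 2, k, g]) xs bs y"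
| P8: "(\<And>x. pkleene \<Phi> R h (x # xs) (b # bs) (u x)) \<Longrightarrow>
       (if b then (u, v) \<in> R else v = \<Phi> u) \<Longrightarrow>
       pkleene \<Phi> R (list_encode [8, h]) xs (b # bs) v"
| P9: "m0 \<le> length xs \<Longrightarrow> m2 \<le> length bs \<Longrightarrow>
       pkleene \<Phi> R d (take m0 xs) (take m2 bs) y \<Longrightarrow>
       pkleene \<Phi> R (list_encode [9, m0, m1, m2]) (d # xs) bs y"

declare list_encode.simps [simp del] One_nat_def [simp del] list_encode_eq [simp]

text \<open>\<open>R\<close> occurs only positively in the rules: P8 may ask that a pair lie in
  \<open>R\<close>, never that one be absent.\<close>

lemma pkleene_mono:
  assumes "pkleene \<Phi> R e xs bs y" and "R \<subseteq> R'"
  shows "pkleene \<Phi> R' e xs bs y"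
  using assms
proof (induction rule: pkleene.induct)
  case (P8 h xs b bs u v)
  then show ?case by (intro pkleene.P8[of _ _ _ _ _ _ u]) (auto split: if_splits)
qed (auto intro: pkleene.intros)

inductive_cases pkleene_cases:
  "pkleene \<Phi> R (list_encode [1]) xs bs y"
  "pkleene \<Phi> R (list_encode [2, q]) xs bs y"
  "pkleene \<Phi> R (list_encode [3]) xs bs y"
  "pkleene \<Phi> R (list_encode [4, g, h]) xs bs y"
  "pkleene \<Phi> R (list_encode [5, g, h]) (0 # xs) bs y"
  "pkleene \<Phi> R (list_encode [5, g, h]) (Suc x # xs) bs y"
  "pkleene \<Phi> R (list_encode [6, 0, k, g]) xs bs y"
  "pkleene \<Phi> R (list_encode [6, 2, k, g]) xs bs y"
  "pkleene \<Phi> R (list_encode [8, h]) xs bs y"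
  "pkleene \<Phi> R (list_encode [9, m0, m1, m2]) xs bs y"

text \<open>Injectivity of \<open>list_encode\<close> leaves one scheme per index, with the first
  argument deciding between P5_0 and P5_Suc. In P8 the induction hypothesis fixes the inner
  function, and \<open>single_valued R\<close> then fixes the value at it.\<close>

lemma pkleene_unique:
  assumes "pkleene \<Phi> R e xs bs y" and "single_valued R" and "pkleene \<Phi> R e xs bs y'"
  shows "y = y'"
  using assms
proof (induction arbitrary: y' rule: pkleene.induct)
  case (P8 h xs b bs u v)
  from P8.prems(2) obtain u'
    where u': "\<And>x. pkleene \<Phi> R h (x # xs) (b # bs) (u' x)" "if b then (u', y') \<in> R else y' = \<Phi> u'"
    by (rule pkleene_cases(9)) auto
  have "u = u'" by (rule ext) (rule P8.IH[OF P8.prems(1) u'(1)])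
  then show ?case using P8.hyps u'(2) P8.prems(1) by (auto simp: single_valued_def split: if_splits)
next
  case (P4 h xs bs y g z)
  from P4.prems(2) show ?case
    by (rule pkleene_cases(4)) (use P4 in blast)
next
  case (P5_Suc g h x xs bs y z)
  from P5_Suc.prems(2) show ?case
    by (rule pkleene_cases(6)) (use P5_Suc in blast)
next
  case (P5_0 g xs bs y h)
  from P5_0.prems(2) show ?case
    by (rule pkleene_cases(5)) (use P5_0 in blast)
next
  case (P6_0 k xs g bs y)
  from P6_0.prems(2) show ?case
    by (rule pkleene_cases(7)) (use P6_0 in blast)
next
  case (P6_2 k bs g xs y)
  from P6_2.prems(2) show ?case
    by (rule pkleene_cases(8)) (use P6_2 in blast)
next
  case (P9 m0 xs m2 bs d y m1)
  from P9.prems(2) show ?case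
    by (rule pkleene_cases(10)) (use P9 in blast)
next
  case (P1 x xs bs)
  from P1(2) show ?case by (rule pkleene_cases(1)) simp
next
  case (P2 q xs bs)
  from P2(2) show ?case by (rule pkleene_cases(2)) simp
next
  case (P3 x xs bs)
  from P3(2) show ?case by (rule pkleene_cases(3)) simp
qed

lemma move_to_front_map:
  "k < length xs \<Longrightarrow> move_to_front k (map f xs) = map f (move_to_front k xs)"
  by (simp add: move_to_front_def take_map drop_map)

text \<open>The triples serve as codes of computations: they form a countable type, so
  \<open>to_nat\<close> numbers them. The varying argument comes first to match P8.\<close>

definition pcomputes ::
  "type2 \<Rightarrow> (type1 \<times> nat) set \<Rightarrow> nat \<times> nat list \<times> bool list \<Rightarrow> type1 \<Rightarrow> bool" where
  "pcomputes \<Phi> R = (\<lambda>(h, xs, bs) u. \<forall>x. pkleene \<Phi> R h (x # xs) bs (u x))"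

lemma pcomputes_mono: "pcomputes \<Phi> R c u \<Longrightarrow> R \<subseteq> R' \<Longrightarrow> pcomputes \<Phi> R' c u"
  by (auto simp: pcomputes_def intro: pkleene_mono)

lemma pcomputes_unique:
  "single_valued R \<Longrightarrow> pcomputes \<Phi> R c u \<Longrightarrow> pcomputes \<Phi> R c u' \<Longrightarrow> u = u'"
  by (auto simp: pcomputes_def fun_eq_iff intro: pkleene_unique)

text \<open>When S8 applies \<open>G\<close>, the induction hypothesis shows that the inner function
  has a code relative to \<open>R\<close>, so \<open>closed\<close> yields the premise of
  P8.\<close>

lemma kleene_imp_pkleene:
  assumes "kleene e xs [] (map (\<lambda>b. if b then G else \<Phi>) bs) y"
    and closed: "\<And>c u. pcomputes \<Phi> R c u \<Longrightarrow> (u, G u) \<in> R"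
  shows "pkleene \<Phi> R e xs bs y"
proof -
  let ?o = "map (\<lambda>b. if b then G else \<Phi>)"
  \<comment> \<open>With \<open>F u\<close> in place of \<open>v\<close>, higher-order unification would not terminate.\<close>
  have S8: "pkleene \<Phi> R (list_encode [8, h]) xs bs v"
    if IH: "\<And>x bs. fs = [] \<Longrightarrow> F # Fs = ?o bs \<Longrightarrow> pkleene \<Phi> R h (x # xs) bs (u x)"
      and prems: "fs = []" "F # Fs = ?o bs" "v = F u"
    for h xs fs F Fs u bs v
  proof -
    obtain b bs' where bs: "bs = b # bs'" "F = (if b then G else \<Phi>)"
      using prems(2) by (cases bs) auto
    have *: "pkleene \<Phi> R h (x # xs) (b # bs') (u x)" for x
      using IH[OF prems(1,2)] bs(1) by simp
    then have "(u, G u) \<in> R"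
      using closed[of "(h, xs, b # bs')" u] by (simp add: pcomputes_def)
    then have "if b then (u, v) \<in> R else v = \<Phi> u"
      using bs(2) prems(3) by simp
    then show ?thesis
      unfolding bs(1) using * by (rule pkleene.P8[rotated])
  qed
  have "pkleene \<Phi> R e xs bs y" if "kleene e xs fs Fs y" "fs = []" "Fs = ?o bs" for fs Fs
    using that
  proof (induction arbitrary: bs rule: kleene.induct)
    case (S6_2 k Fs g xs fs y)
    then show ?case by (auto simp: move_to_front_map intro!: pkleene.P6_2)
  next
    case (S9 m0 xs m1 fs m2 Fs d y)
    then show ?case by (auto simp: take_map intro!: pkleene.P9)
  qed ((rule S8, assumption, assumption, assumption, rule refl) |
       (simp add: pkleene.intros(1-3); fail) | (force intro: pkleene.intros(4-7)))+
  with assms(1) show ?thesis by blast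
qed

lemma exists_injective_oracle:
  obtains G :: type2 and R :: "(type1 \<times> nat) set" where
    "\<And>c u. pcomputes \<Phi> R c u \<Longrightarrow> (u, G u) \<in> R"
    "\<And>u u' v. (u, v) \<in> R \<Longrightarrow> (u', v) \<in> R \<Longrightarrow> u = u'"
    "\<And>u. (u, 0) \<notin> R"
proof -
  \<comment> \<open>The successor keeps 0 free, so that no initial segment of length
    \<open>v\<close> is empty.\<close>
  define A where "A = {R. single_valued R \<and>
    (\<forall>(u, v)\<in>R. \<exists>c. v = Suc (to_nat c) \<and> pcomputes \<Phi> R c u)}"
  have "\<exists>M\<in>A. \<forall>R\<in>A. M \<subseteq> R \<longrightarrow> R = M"
  proof (rule subset_Zorn', unfold subset_chain_def)
    fix C assume C: "C \<subseteq> A \<and> (\<forall>R\<in>C. \<forall>R'\<in>C. R \<subseteq> R' \<or> R' \<subseteq> R)"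
    have "single_valued (\<Union>C)"
    proof (rule single_valuedI)
      fix u v w assume "(u, v) \<in> \<Union>C" "(u, w) \<in> \<Union>C"
      then obtain R where "R \<in> C" "(u, v) \<in> R" "(u, w) \<in> R"
        using C by blast
      then show "v = w" using C by (auto simp: A_def single_valued_def)
    qed
    moreover have "\<exists>c. v = Suc (to_nat c) \<and> pcomputes \<Phi> (\<Union>C) c u"
      if uv: "(u, v) \<in> \<Union>C" for u v
    proof -
      obtain R where R: "R \<in> C" "(u, v) \<in> R" using uv by blast
      then have "R \<in> A" using C by blast
      with R(2) obtain c where c: "v = Suc (to_nat c)" "pcomputes \<Phi> R c u"
        unfolding A_def by blast
      have "R \<subseteq> \<Union>C" using R(1) by blast
      from pcomputes_mono[OF c(2) this] c(1) show ?thesis by blast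
    qed
    ultimately show "\<Union>C \<in> A" unfolding A_def by blast
  qed
  then obtain R where "R \<in> A" and maximal: "\<And>R'. R' \<in> A \<Longrightarrow> R \<subseteq> R' \<Longrightarrow> R' = R" by blast
  then have sv: "single_valued R"
    and good: "\<And>u v. (u, v) \<in> R \<Longrightarrow> \<exists>c. v = Suc (to_nat c) \<and> pcomputes \<Phi> R c u"
    unfolding A_def by blast+
  \<comment> \<open>Off the domain of \<open>R\<close> the value is arbitrary.\<close>
  define G where "G u = (SOME v. (u, v) \<in> R)" for u
  have "(u, G u) \<in> R" if c: "pcomputes \<Phi> R c u" for c u
  proof -
    have "\<exists>v. (u, v) \<in> R"
    proof (rule ccontr)
      assume new: "\<nexists>v. (u, v) \<in> R"
      \<comment> \<open>By monotonicity \<open>c\<close> still computes \<open>u\<close> relative to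
        the larger relation, so \<open>u\<close> may receive its own code.\<close>
      let ?R = "insert (u, Suc (to_nat c)) R"
      have "single_valued ?R"
        using sv new by (auto simp: single_valued_def)
      moreover have "\<exists>c. v = Suc (to_nat c) \<and> pcomputes \<Phi> ?R c w" if "(w, v) \<in> ?R" for w v
      proof -
        have "\<exists>c. v = Suc (to_nat c) \<and> pcomputes \<Phi> R c w"
          using that c good by blast
        then show ?thesis using pcomputes_mono[OF _ subset_insertI] by blast
      qed
      ultimately have "?R \<in> A" unfolding A_def by blast
      then show False using maximal new by blast
    qed
    then show ?thesis unfolding G_def by (rule someI_ex)
  qed
  moreover have "u = u'" if "(u, v) \<in> R" "(u', v) \<in> R" for u u' v
    using good[OF that(1)] good[OF that(2)] pcomputes_unique[OF sv] by auto
  moreover have "(u, 0) \<notin> R" for u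
    using good by blast
  ultimately show thesis by (rule that)
qed

lemma not_SFF_if_inj_on:
  assumes inj: "inj_on G (set (\<Theta> G))" and pos: "\<And>g. g \<in> set (\<Theta> G) \<Longrightarrow> G g \<noteq> 0"
  shows "\<not> SFF \<Theta>"
proof
  assume "SFF \<Theta>"
  \<comment> \<open>If no entry has value \<open>Suc p\<close>, then \<open>inv_into\<close> is
    unspecified, but \<open>f p\<close> is still 0 or 1.\<close>
  define f :: type1 where
    "f p = (if inv_into (set (\<Theta> G)) G (Suc p) p = 0 then 1 else 0)" for p
  have "f \<in> Cantor_space" by (simp add: f_def Cantor_space_def)
  with \<open>SFF \<Theta>\<close> obtain g where g: "g \<in> set (\<Theta> G)" "f \<in> neighbourhood (initial_segment g (G g))"
    unfolding SFF_def by blast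
  obtain p where p: "G g = Suc p" using pos[OF g(1)] by (cases "G g") auto
  \<comment> \<open>Position \<open>p\<close> is the last one in a segment of length
    \<open>Suc p\<close>.\<close>
  have "f p = g p"
    using g(2) p by (simp add: neighbourhood_def initial_segment_def del: upt_Suc)
  moreover have "inv_into (set (\<Theta> G)) G (Suc p) = g"
    using inv_into_f_f[OF inj g(1)] p by simp
  ultimately show False by (simp add: f_def split: if_splits)
qed

theorem not_SFF_if_computable_in:
  assumes "computable_in \<Theta> \<Phi>"
  shows "\<not> SFF \<Theta>"
proof -
  obtain G and R :: "(type1 \<times> nat) set" where
    closed: "\<And>c u. pcomputes \<Phi> R c u \<Longrightarrow> (u, G u) \<in> R" and
    inj: "\<And>u u' v. (u, v) \<in> R \<Longrightarrow> (u', v) \<in> R \<Longrightarrow> u = u'" and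
    pos: "\<And>u. (u, 0) \<notin> R"
    using exists_injective_oracle[of \<Phi>] by metis
  obtain e where e: "\<And>i n. i < length (\<Theta> G) \<Longrightarrow> kleene e [i, n] [] [\<Phi>, G] ((\<Theta> G ! i) n)"
    using assms unfolding computable_in_def by blast
  have dom: "(g, G g) \<in> R" if g: "g \<in> set (\<Theta> G)" for g
  proof -
    obtain i where i: "i < length (\<Theta> G)" "g = \<Theta> G ! i"
      using g by (metis in_set_conv_nth)
    have "pkleene \<Phi> R e [i, n] [False, True] (g n)" for n
      using kleene_imp_pkleene[OF _ closed, where e = e and xs = "[i, n]" and bs = "[False, True]"] e[OF i(1)] i(2) by simp
    \<comment> \<open>A code needs its varying argument in front, but \<open>e\<close> expects
      \<open>i\<close> before \<open>n\<close>; an S6 index swaps them.\<close>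
    then have "pkleene \<Phi> R (list_encode [6, 0, 1, e]) [n, i] [False, True] (g n)" for n
      by (intro pkleene.P6_0) (simp_all add: move_to_front_def take_Cons')
    then show ?thesis
      using closed[of "(list_encode [6, 0, 1, e], [i], [False, True])" g]
      by (simp add: pcomputes_def)
  qed
  show ?thesis
  proof (rule not_SFF_if_inj_on)
    show "inj_on G (set (\<Theta> G))" using dom inj by (metis inj_onI)
    show "G g \<noteq> 0" if "g \<in> set (\<Theta> G)" for g using dom[OF that] pos by metis
  qed
qed

theorem theorem3p7:
  "\<not> (\<exists>\<Theta> :: type2 \<Rightarrow> type1 list. SFF \<Theta> \<and> computable_in \<Theta> exists2)"
  using not_SFF_if_computable_in by blast

end
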